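(* For a combinatorial auction with $m\ge2$ items and $n\ge2$ bidders with additive valuations, there is no randomized mechanism that is universally obviously strategy-proof, satisfies individual rationality and no negative transfers, and gives an approximation better than $\frac{8}{7}$ to the optimal social welfare; i.e., every such mechanism has $\sup_{v}\mathrm{OPT}(v)/\mathbb{E}[W(v)]\ge 8/7$.
   Context: A valuation $v_i:2^M\to\mathbb{R}_{\ge 0}$ is additive if $v_i(A)=\sum_{j\in A}v_{ij}$ for some $v_{ij}\ge0$. Each bidder's domain $V_i$ is the set of additive valuations (publicly known), valuations are private, utilities quasi-linear. A deterministic mechanism is a rooted tree: each internal node is assigned to one bidder, who sends one of the messages labeling the outgoing edges; each leaf is labeled with a feasible allocation (disjoint bundles) and a payment for each bidder. A behavior $B_i$ specifies a message at every node of bidder $i$; a profile $B$ determines a root-to-leaf path $\mathrm{Path}(B)$ with bundle $f_i(B)$ and payment $p_i(B)$ for $i$. A strategy $\mathcal S_i$ maps each $v_i\in V_i$ to a behavior; it is obviously dominant if for every $v_i\in V_i$, every node $u$ of $i$, every $B_{-i}$ and every profile $B'$ with $u\in\mathrm{Path}(\mathcal S_i(v_i),B_{-i})\cap\mathrm{Path}(B')$ and $B'_i$ sending at $u$ a message different from $\mathcal S_i(v_i)$'s, $v_i(f_i(\mathcal S_i(v_i),B_{-i}))-p_i(\mathcal S_i(v_i),B_{-i})\ge v_i(f_i(B'))-p_i(B')$. A randomized mechanism is a probability distribution over deterministic mechanisms each equipped with strategies; it is universally OSP if all strategies in every mechanism of its support are obviously dominant. Individual rationality: in every mechanism of the support,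 for every profile in $\prod_i V_i$, following the strategies gives each bidder utility $\ge0$. No negative transfers: every payment at every leaf of every mechanism in the support is $\ge 0$. $\mathbb{E}[W(v)]$ is the expected welfare of the allocation reached when bidders follow their strategies on profile $v$; $\mathrm{OPT}(v)$ is the optimal welfare. *)

theory Defs
  imports "HOL-Probability.Probability"
begin

text \<open>Bidders are 0..<n, items are 0..<m.  An additive valuation of a bidder is
  represented by its vector of item values (nat \<Rightarrow> real), nonnegative on the items
  and 0 outside the item set (canonical representation).\<close>

definition additive_vals :: "nat \<Rightarrow> (nat \<Rightarrow> real) set" where
  "additive_vals m = {w. (\<forall>j<m. 0 \<le> w j) \<and> (\<forall>j\<ge>m. w j = 0)}"

definition bval :: "(nat \<Rightarrow> real) \<Rightarrow> nat set \<Rightarrow> real" where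
  "bval w A = (\<Sum>j\<in>A. w j)"

definition profiles :: "nat \<Rightarrow> nat \<Rightarrow> (nat \<Rightarrow> nat \<Rightarrow> real) set" where
  "profiles n m = {v. \<forall>i<n. v i \<in> additive_vals m}"

definition feasible :: "nat \<Rightarrow> nat \<Rightarrow> (nat \<Rightarrow> nat set) \<Rightarrow> bool" where
  "feasible n m A \<longleftrightarrow> (\<forall>i<n. A i \<subseteq> {..<m}) \<and>
     (\<forall>i<n. \<forall>k<n. i \<noteq> k \<longrightarrow> A i \<inter> A k = {})"

definition welfare :: "nat \<Rightarrow> (nat \<Rightarrow> nat \<Rightarrow> real) \<Rightarrow> (nat \<Rightarrow> nat set) \<Rightarrow> real" where
  "welfare n v A = (\<Sum>i<n. bval (v i) (A i))"

definition OPT :: "nat \<Rightarrow> nat \<Rightarrow> (nat \<Rightarrow> nat \<Rightarrow> real) \<Rightarrow> real" where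
  "OPT n m v = Max {welfare n v A | A. feasible n m A}"

text \<open>Deterministic mechanisms: rooted trees. A leaf carries an allocation (bundle of
  each bidder) and payments; an internal node is assigned to a bidder, carries the set of
  messages labelling its outgoing edges, and a child for each message.  Nodes are
  identified by the sequence of messages from the root (their history).\<close>
datatype 'msg mech =
    Leaf "nat \<Rightarrow> nat set" "nat \<Rightarrow> real"
  | Node nat "'msg set" "'msg \<Rightarrow> 'msg mech"

fun node_at :: "'msg mech \<Rightarrow> 'msg list \<Rightarrow> 'msg mech option" where
  "node_at T [] = Some T"
| "node_at (Leaf A p) (x # xs) = None"
| "node_at (Node i Ms c) (x # xs) = (if x \<in> Ms then node_at (c x) xs else None)"

definition wf_mech :: "nat \<Rightarrow> nat \<Rightarrow> 'msg mech \<Rightarrow> bool" where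
  "wf_mech n m T \<longleftrightarrow>
     (\<forall>h i Ms c. node_at T h = Some (Node i Ms c) \<longrightarrow> i < n \<and> Ms \<noteq> {}) \<and>
     (\<forall>h A p. node_at T h = Some (Leaf A p) \<longrightarrow> feasible n m A)"

definition no_neg_transfers :: "nat \<Rightarrow> 'msg mech \<Rightarrow> bool" where
  "no_neg_transfers n T \<longleftrightarrow>
     (\<forall>h A p. node_at T h = Some (Leaf A p) \<longrightarrow> (\<forall>i<n. 0 \<le> p i))"

text \<open>A behavior of a bidder maps (the history of) each node to a message; it is valid
  for bidder i if at every node of i it sends one of the messages of that node.\<close>
type_synonym 'msg behavior = "'msg list \<Rightarrow> 'msg"

definition valid_behavior :: "'msg mech \<Rightarrow> nat \<Rightarrow> 'msg behavior \<Rightarrow> bool" where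
  "valid_behavior T i b \<longleftrightarrow> (\<forall>h Ms c. node_at T h = Some (Node i Ms c) \<longrightarrow> b h \<in> Ms)"

definition valid_profile :: "nat \<Rightarrow> 'msg mech \<Rightarrow> (nat \<Rightarrow> 'msg behavior) \<Rightarrow> bool" where
  "valid_profile n T B \<longleftrightarrow> (\<forall>i<n. valid_behavior T i (B i))"

primrec outcome_from :: "'msg mech \<Rightarrow> (nat \<Rightarrow> 'msg behavior) \<Rightarrow> 'msg list
    \<Rightarrow> (nat \<Rightarrow> nat set) \<times> (nat \<Rightarrow> real)" where
  "outcome_from (Leaf A p) B h = (A, p)"
| "outcome_from (Node i Ms c) B h = outcome_from (c (B i h)) B (h @ [B i h])"

definition outcome :: "'msg mech \<Rightarrow> (nat \<Rightarrow> 'msg behavior) \<Rightarrow> (nat \<Rightarrow> nat set) \<times> (nat \<Rightarrow> real)" where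
  "outcome T B = outcome_from T B []"

primrec visits_from :: "'msg mech \<Rightarrow> (nat \<Rightarrow> 'msg behavior) \<Rightarrow> 'msg list \<Rightarrow> 'msg list set" where
  "visits_from (Leaf A p) B h = {}"
| "visits_from (Node i Ms c) B h = insert h (visits_from (c (B i h)) B (h @ [B i h]))"

definition visits :: "'msg mech \<Rightarrow> (nat \<Rightarrow> 'msg behavior) \<Rightarrow> 'msg list set" where
  "visits T B = visits_from T B []"

definition utility :: "'msg mech \<Rightarrow> (nat \<Rightarrow> 'msg behavior) \<Rightarrow> nat \<Rightarrow> (nat \<Rightarrow> real) \<Rightarrow> real" where
  "utility T B i w = bval w (fst (outcome T B) i) - snd (outcome T B) i"

type_synonym 'msg strategies = "nat \<Rightarrow> (nat \<Rightarrow> real) \<Rightarrow> 'msg behavior"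

definition valid_strategies :: "nat \<Rightarrow> nat \<Rightarrow> 'msg mech \<Rightarrow> 'msg strategies \<Rightarrow> bool" where
  "valid_strategies n m T S \<longleftrightarrow> (\<forall>i<n. \<forall>w\<in>additive_vals m. valid_behavior T i (S i w))"

definition obviously_dominant :: "nat \<Rightarrow> nat \<Rightarrow> 'msg mech \<Rightarrow> 'msg strategies \<Rightarrow> nat \<Rightarrow> bool" where
  "obviously_dominant n m T S i \<longleftrightarrow>
     (\<forall>w\<in>additive_vals m. \<forall>u Ms c B B'.
        node_at T u = Some (Node i Ms c) \<longrightarrow>
        valid_profile n T B \<longrightarrow> valid_profile n T B' \<longrightarrow>
        B i = S i w \<longrightarrow>
        u \<in> visits T B \<longrightarrow> u \<in> visits T B' \<longrightarrow>
        B' i u \<noteq> S i w u \<longrightarrow>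
        utility T B' i w \<le> utility T B i w)"

definition indiv_rational :: "nat \<Rightarrow> nat \<Rightarrow> 'msg mech \<Rightarrow> 'msg strategies \<Rightarrow> bool" where
  "indiv_rational n m T S \<longleftrightarrow>
     (\<forall>v\<in>profiles n m. \<forall>i<n. 0 \<le> utility T (\<lambda>k. S k (v k)) i (v i))"

definition mech_welfare :: "nat \<Rightarrow> 'msg mech \<times> 'msg strategies \<Rightarrow> (nat \<Rightarrow> nat \<Rightarrow> real) \<Rightarrow> real" where
  "mech_welfare n D v = welfare n v (fst (outcome (fst D) (\<lambda>k. snd D k (v k))))"

definition good_det_mech :: "nat \<Rightarrow> nat \<Rightarrow> 'msg mech \<times> 'msg strategies \<Rightarrow> bool" where
  "good_det_mech n m D \<longleftrightarrow>
     wf_mech n m (fst D) \<and> valid_strategies n m (fst D) (snd D) \<and>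
     (\<forall>i<n. obviously_dominant n m (fst D) (snd D) i) \<and>
     indiv_rational n m (fst D) (snd D) \<and> no_neg_transfers n (fst D)"

end

theory Submission
  imports Defs
begin

text \<open>Only two bidders and two items matter. With a large parameter \<open>K\<close>, the first bidder has one of
  the types \<open>x = (1, 0)\<close>, \<open>z = (3, K)\<close>, \<open>w = (2K, K + 1)\<close>, and the second bidder has the same types with
  the two items exchanged. By averaging, it suffices to bound the welfare of a deterministic mechanism
  on the profiles \<open>(x, x)\<close>, \<open>(z, w)\<close> and \<open>(w, z)\<close>, weighted proportionally to \<open>3K + 1\<close>, \<open>3\<close> and \<open>3\<close>.
  If it is nearly optimal on all three, then an \<open>x\<close> bidder gets its own item at a price of at most 1, a
  \<open>w\<close> bidder gets both items and a \<open>z\<close> bidder gets nothing. Consider the first node at which the types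
  of some bidder send different messages. If \<open>z\<close> separates from \<open>x\<close> there, then \<open>z\<close>, who may end up
  with nothing, would rather imitate \<open>x\<close>. Otherwise \<open>w\<close> separates from both; not imitating \<open>x\<close>
  requires \<open>w\<close> to pay at most \<open>K + 2\<close> for the two items, which \<open>z\<close> values at \<open>K + 3\<close>, so \<open>z\<close> would rather
  imitate \<open>w\<close>. If there is no such node, the allocation is constant. Hence at least one profile loses
  about 1/8 of the total weighted optimum.\<close>

section \<open>Runs of a mechanism\<close>

text \<open>Induction on the tree. Behaviors read histories from the root of the whole mechanism,
  while \<open>r\<close> is relative to the current subtree, so the prefix \<open>h\<close> is
  generalized.\<close>

lemma outcome_from_is_leaf:
  assumes "\<And>r j Ms c. node_at T r = Some (Node j Ms c) \<Longrightarrow> B j (h @ r) \<in> Ms"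
  shows "\<exists>r A p. node_at T r = Some (Leaf A p) \<and> outcome_from T B h = (A, p)"
  using assms
proof (induction T arbitrary: h)
  case (Leaf A p)
  have "node_at (Leaf A p) [] = Some (Leaf A p)" by simp
  then show ?case by fastforce
next
  case (Node i Ms c)
  have msg: "B i h \<in> Ms" using Node.prems[of "[]"] by simp
  have "\<exists>r A p. node_at (c (B i h)) r = Some (Leaf A p) \<and>
      outcome_from (c (B i h)) B (h @ [B i h]) = (A, p)"
  proof (rule Node.IH)
    fix r j Ms' c' assume "node_at (c (B i h)) r = Some (Node j Ms' c')"
    then show "B j ((h @ [B i h]) @ r) \<in> Ms'"
      using Node.prems[of "B i h # r"] msg by simp
  qed simp
  then obtain r A p where "node_at (c (B i h)) r = Some (Leaf A p)"
    "outcome_from (c (B i h)) B (h @ [B i h]) = (A, p)" by blast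
  then show ?case using msg by (intro exI[of _ "B i h # r"]) simp
qed

text \<open>Descend from the root while all members of \<open>X\<close> send the same message. The
  descent ends at a leaf, which is then the common outcome, or at a node that every run visits and
  where two members differ.\<close>

lemma first_divergence_from:
  assumes "\<And>B r j Ms c. B \<in> X \<Longrightarrow> node_at T r = Some (Node j Ms c) \<Longrightarrow> B j (h @ r) \<in> Ms"
  shows "(\<exists>out. \<forall>B\<in>X. outcome_from T B h = out) \<or>
    (\<exists>r j Ms c. node_at T r = Some (Node j Ms c) \<and> (\<forall>B\<in>X. h @ r \<in> visits_from T B h) \<and>
       (\<exists>B\<in>X. \<exists>B'\<in>X. B j (h @ r) \<noteq> B' j (h @ r)))"
  using assms
proof (induction T arbitrary: h)
  case (Leaf A p)
  then show ?case by auto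
next
  case (Node i Ms c)
  show ?case
  proof (cases "\<exists>B\<in>X. \<exists>B'\<in>X. B i h \<noteq> B' i h")
    case True
    then show ?thesis
      by (intro disjI2 exI[of _ "[]"]) auto
  next
    case False
    show ?thesis
    \<comment> \<open>A common message can be named only if \<open>X\<close> has a member; for empty
      \<open>X\<close> the first alternative holds vacuously.\<close>
    proof (cases "X = {}")
      case False
      then obtain B0 where "B0 \<in> X" by blast
      define x where "x = B0 i h"
      have eq: "B i h = x" if "B \<in> X" for B
        using that \<open>B0 \<in> X\<close> \<open>\<not> (\<exists>B\<in>X. \<exists>B'\<in>X. B i h \<noteq> B' i h)\<close> x_def by blast
      have x: "x \<in> Ms" using Node.prems[OF \<open>B0 \<in> X\<close>, of "[]"] x_def by simp
      have "(\<exists>out. \<forall>B\<in>X. outcome_from (c x) B (h @ [x]) = out) \<or>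
        (\<exists>r j Ms' c'. node_at (c x) r = Some (Node j Ms' c') \<and>
           (\<forall>B\<in>X. (h @ [x]) @ r \<in> visits_from (c x) B (h @ [x])) \<and>
           (\<exists>B\<in>X. \<exists>B'\<in>X. B j ((h @ [x]) @ r) \<noteq> B' j ((h @ [x]) @ r)))"
      proof (rule Node.IH)
        fix B r j Ms' c' assume "B \<in> X" "node_at (c x) r = Some (Node j Ms' c')"
        then show "B j ((h @ [x]) @ r) \<in> Ms'"
          using Node.prems[of B "x # r"] x by simp
      qed simp
      then show ?thesis
      proof (elim disjE exE conjE)
        fix out assume "\<forall>B\<in>X. outcome_from (c x) B (h @ [x]) = out"
        then show ?thesis using eq by auto
      next
        fix r j Ms' c'
        assume "node_at (c x) r = Some (Node j Ms' c')"
          "\<forall>B\<in>X. (h @ [x]) @ r \<in> visits_from (c x) B (h @ [x])"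
          "\<exists>B\<in>X. \<exists>B'\<in>X. B j ((h @ [x]) @ r) \<noteq> B' j ((h @ [x]) @ r)"
        then show ?thesis
          using x eq by (intro disjI2 exI[of _ "x # r"] exI[of _ j] exI[of _ Ms'] exI[of _ c']) auto
      qed
    qed auto
  qed
qed

section \<open>Legal runs of a well-formed mechanism\<close>

context
  fixes n m :: nat and T :: "'msg mech"
  assumes wf: "wf_mech n m T"
begin

lemma valid_profile_message:
  assumes "valid_profile n T B" "node_at T r = Some (Node j Ms c)"
  shows "B j r \<in> Ms"
  using assms wf unfolding valid_profile_def valid_behavior_def wf_mech_def by blast

lemma outcome_is_leaf:
  assumes "valid_profile n T B"
  obtains r where "node_at T r = Some (Leaf (fst (outcome T B)) (snd (outcome T B)))"
proof -
  have "\<exists>r A p. node_at T r = Some (Leaf A p) \<and> outcome_from T B [] = (A, p)"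
    by (rule outcome_from_is_leaf) (simp add: valid_profile_message[OF assms])
  then show thesis using that unfolding outcome_def by auto
qed

lemma feasible_outcome:
  assumes "valid_profile n T B"
  shows "feasible n m (fst (outcome T B))"
  by (rule outcome_is_leaf[OF assms]) (use wf in \<open>unfold wf_mech_def, blast\<close>)

lemma payment_nonneg:
  assumes "valid_profile n T B" "no_neg_transfers n T" "i < n"
  shows "0 \<le> snd (outcome T B) i"
  by (rule outcome_is_leaf[OF assms(1)]) (use assms in \<open>unfold no_neg_transfers_def, blast\<close>)

lemma first_divergence:
  assumes "\<And>B. B \<in> X \<Longrightarrow> valid_profile n T B"
  shows "(\<exists>out. \<forall>B\<in>X. outcome T B = out) \<or>
    (\<exists>u j Ms c. node_at T u = Some (Node j Ms c) \<and> (\<forall>B\<in>X. u \<in> visits T B) \<and>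
       (\<exists>B\<in>X. \<exists>B'\<in>X. B j u \<noteq> B' j u))"
  unfolding outcome_def visits_def
  by (rule first_divergence_from[of X T "[]", unfolded append_Nil])
    (rule valid_profile_message[OF assms])

end

lemma good_mech_feasible:
  assumes "good_det_mech n m D" "v \<in> profiles n m"
  shows "feasible n m (fst (outcome (fst D) (\<lambda>k. snd D k (v k))))"
proof (rule feasible_outcome)
  show "wf_mech n m (fst D)" using assms(1) unfolding good_det_mech_def by blast
  show "valid_profile n (fst D) (\<lambda>k. snd D k (v k))"
    using assms unfolding good_det_mech_def valid_profile_def valid_strategies_def profiles_def
    by blast
qed

text \<open>At \<open>u\<close>, obvious dominance forbids a type to prefer any run of a deviating
  message to any run of its own. So \<open>z\<close>, idle in \<open>B2\<close>, cannot separate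
  from \<open>x\<close>. If \<open>w\<close> separates from \<open>z\<close>, it separates from
  \<open>x\<close> too, so neither may \<open>z\<close> envy \<open>w\<close> nor \<open>w\<close>
  envy \<open>x\<close>; the last hypothesis says that one of them does.\<close>

lemma no_separation:
  assumes od: "obviously_dominant n m T S i"
    and types: "x \<in> additive_vals m" "z \<in> additive_vals m" "w \<in> additive_vals m"
    and u: "node_at T u = Some (Node i Ms c)"
    and valid: "valid_profile n T B1" "valid_profile n T B2" "valid_profile n T B3"
    and visit: "u \<in> visits T B1" "u \<in> visits T B2" "u \<in> visits T B3"
    and follow: "B1 i = S i x" "B2 i = S i z" "B3 i = S i w"
    and z_idle: "utility T B2 i z \<le> 0"
    and z_envies_x: "0 < utility T B1 i z"
    and envy_after_w: "0 < utility T B3 i z \<or> utility T B3 i w < utility T B1 i w"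
  shows "S i x u = S i z u" "S i w u = S i z u"
proof -
  have dom: "utility T B' i y \<le> utility T B i y"
    if "y \<in> additive_vals m" "valid_profile n T B" "valid_profile n T B'" "B i = S i y"
      "u \<in> visits T B" "u \<in> visits T B'" "B' i u \<noteq> S i y u" for y B B'
    using od u that unfolding obviously_dominant_def by blast
  show xz: "S i x u = S i z u"
  proof (rule ccontr)
    assume "S i x u \<noteq> S i z u"
    then have "utility T B1 i z \<le> utility T B2 i z"
      using types valid visit follow by (intro dom) auto
    then show False using z_idle z_envies_x by simp
  qed
  show "S i w u = S i z u"
  proof (rule ccontr)
    assume ne: "S i w u \<noteq> S i z u"
    then have "utility T B3 i z \<le> utility T B2 i z"
      using types valid visit follow by (intro dom) auto
    \<comment> \<open>By \<open>xz\<close>, the message of \<open>x\<close> is that of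
      \<open>z\<close>, hence also a deviation for \<open>w\<close>.\<close>
    moreover have "utility T B1 i w \<le> utility T B3 i w"
      using types valid visit follow ne xz by (intro dom) auto
    ultimately show False using z_idle envy_after_w by linarith
  qed
qed

section \<open>Two bidders and two items\<close>

definition two_items :: "real \<Rightarrow> real \<Rightarrow> nat \<Rightarrow> real" where
  "two_items a b = (\<lambda>j. if j = 0 then a else if j = 1 then b else 0)"

text \<open>All further bidders get the zero valuation: they add nothing to welfare, and their
  behavior is the same on all hard instances.\<close>

definition two_bidders :: "(nat \<Rightarrow> real) \<Rightarrow> (nat \<Rightarrow> real) \<Rightarrow> nat \<Rightarrow> nat \<Rightarrow> real" where
  "two_bidders y y' = (\<lambda>i. if i = 0 then y else if i = 1 then y' else (\<lambda>_. 0))"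

lemma two_items_additive:
  assumes "2 \<le> m" "0 \<le> a" "0 \<le> b"
  shows "two_items a b \<in> additive_vals m"
  using assms unfolding two_items_def additive_vals_def by auto

lemma two_bidders_profile:
  assumes "y \<in> additive_vals m" "y' \<in> additive_vals m"
  shows "two_bidders y y' \<in> profiles n m"
  using assms unfolding two_bidders_def profiles_def additive_vals_def by auto

lemma bval_two_items:
  assumes "finite A"
  shows "bval (two_items a b) A = (if 0 \<in> A then a else 0) + (if 1 \<in> A then b else 0)"
proof -
  have "bval (two_items a b) A = (\<Sum>j\<in>A. (if j = 0 then a else 0) + (if j = 1 then b else 0))"
    unfolding bval_def two_items_def by (intro sum.cong) auto
  then show ?thesis using assms by (simp add: sum.distrib)
qed

lemma welfare_two_bidders:
  assumes "2 \<le> n"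
  shows "welfare n (two_bidders y y') A = bval y (A 0) + bval y' (A 1)"
proof -
  have "welfare n (two_bidders y y') A
      = (\<Sum>i<n. (if i = 0 then bval y (A 0) else 0) + (if i = 1 then bval y' (A 1) else 0))"
    unfolding welfare_def two_bidders_def bval_def by (intro sum.cong) auto
  then show ?thesis using assms by (simp add: sum.distrib)
qed

text \<open>Feasible allocations are arbitrary beyond index \<open>n\<close>, so there are
  infinitely many; welfare depends only on the restriction to \<open>{..<n}\<close>, which lies in a
  finite function space.\<close>

lemma finite_feasible_welfare: "finite {welfare n v A | A. feasible n m A}"
proof (rule finite_subset)
  show "{welfare n v A | A. feasible n m A} \<subseteq> welfare n v ` (PiE {..<n} (\<lambda>_. Pow {..<m}))"
  proof clarify
    fix A assume "feasible n m A"
    then have "restrict A {..<n} \<in> PiE {..<n} (\<lambda>_. Pow {..<m})"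
      unfolding feasible_def by auto
    moreover have "welfare n v A = welfare n v (restrict A {..<n})"
      unfolding welfare_def by (intro sum.cong) auto
    ultimately show "welfare n v A \<in> welfare n v ` (PiE {..<n} (\<lambda>_. Pow {..<m}))" by blast
  qed
qed (auto intro: finite_PiE)

lemma welfare_le_OPT:
  assumes "feasible n m A"
  shows "welfare n v A \<le> OPT n m v"
  unfolding OPT_def using assms by (intro Max_ge finite_feasible_welfare) blast

section \<open>The hard instances\<close>

context
  fixes n m :: nat and K :: real
  assumes m: "2 \<le> m" and n: "2 \<le> n" and K: "2 \<le> K"
begin

definition typesA :: "(nat \<Rightarrow> real) set" where
  "typesA = {two_items 1 0, two_items 3 K, two_items (2*K) (K+1)}"

definition typesB :: "(nat \<Rightarrow> real) set" where
  "typesB = {two_items 0 1, two_items K 3, two_items (K+1) (2*K)}"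

definition "inst_xx = two_bidders (two_items 1 0) (two_items 0 1)"
definition "inst_zw = two_bidders (two_items 3 K) (two_items (K+1) (2*K))"
definition "inst_wz = two_bidders (two_items (2*K) (K+1)) (two_items K 3)"

lemma types_additive: "typesA \<subseteq> additive_vals m" "typesB \<subseteq> additive_vals m"
  unfolding typesA_def typesB_def using m K by (auto intro!: two_items_additive)

lemma inst_profiles:
  "inst_xx \<in> profiles n m" "inst_zw \<in> profiles n m" "inst_wz \<in> profiles n m"
  unfolding inst_xx_def inst_zw_def inst_wz_def using m K
  by (auto intro!: two_bidders_profile two_items_additive)

lemma OPT_inst:
  "2 \<le> OPT n m inst_xx" "3*K + 1 \<le> OPT n m inst_zw" "3*K + 1 \<le> OPT n m inst_wz"
proof -
  have feas: "feasible n m (\<lambda>i. if i = 0 then {0} else if i = 1 then {1} else {})"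
    "feasible n m (\<lambda>i. if i = 1 then {0,1} else {})"
    "feasible n m (\<lambda>i. if i = 0 then {0,1} else {})"
    using m unfolding feasible_def by auto
  show "2 \<le> OPT n m inst_xx"
    using welfare_le_OPT[OF feas(1), of inst_xx] n
    unfolding inst_xx_def by (simp add: welfare_two_bidders bval_two_items)
  show "3*K + 1 \<le> OPT n m inst_zw"
    using welfare_le_OPT[OF feas(2), of inst_zw] n
    unfolding inst_zw_def by (simp add: welfare_two_bidders bval_two_items)
  show "3*K + 1 \<le> OPT n m inst_wz"
    using welfare_le_OPT[OF feas(3), of inst_wz] n
    unfolding inst_wz_def by (simp add: welfare_two_bidders bval_two_items)
qed

text \<open>The thresholds bound the welfare of every allocation of items 0 and 1 other than the
  intended one. On \<open>inst_zw\<close> and \<open>inst_wz\<close> the value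
  \<open>2*K + 3\<close> arises when bidder 0 gets item 0 and bidder 1 gets item 1.\<close>

lemma welfare_inst:
  assumes "feasible n m A"
  shows "0 \<le> welfare n inst_xx A" "welfare n inst_xx A \<le> 2"
    "0 \<le> welfare n inst_zw A" "welfare n inst_zw A \<le> 3*K + 1"
    "0 \<le> welfare n inst_wz A" "welfare n inst_wz A \<le> 3*K + 1"
    "1 < welfare n inst_xx A \<Longrightarrow> 0 \<in> A 0 \<and> 1 \<notin> A 0 \<and> 0 \<notin> A 1 \<and> 1 \<in> A 1"
    "2*K + 3 < welfare n inst_zw A \<Longrightarrow> 0 \<notin> A 0 \<and> 1 \<notin> A 0 \<and> 0 \<in> A 1 \<and> 1 \<in> A 1"
    "2*K + 3 < welfare n inst_wz A \<Longrightarrow> 0 \<in> A 0 \<and> 1 \<in> A 0 \<and> 0 \<notin> A 1 \<and> 1 \<notin> A 1"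
proof -
  have sub: "A 0 \<subseteq> {..<m}" "A 1 \<subseteq> {..<m}" and disj: "A 0 \<inter> A 1 = {}"
    using assms n unfolding feasible_def by auto
  have fin: "finite (A 0)" "finite (A 1)"
    using sub by (auto intro: finite_subset[OF _ finite_lessThan])
  \<comment> \<open>Welfare depends only on these four memberships, so a finite case analysis
    decides every claim.\<close>
  define p q r t where "p \<longleftrightarrow> 0 \<in> A 0" and "q \<longleftrightarrow> 1 \<in> A 0" and "r \<longleftrightarrow> 0 \<in> A 1" and "t \<longleftrightarrow> 1 \<in> A 1"
  have no: "\<not> (p \<and> r)" "\<not> (q \<and> t)" using disj unfolding p_def q_def r_def t_def by auto
  have W: "welfare n (two_bidders (two_items a b) (two_items a' b')) A =
      (if p then a else 0) + (if q then b else 0) + ((if r then a' else 0) + (if t then b' else 0))"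
    for a b a' b'
    unfolding welfare_two_bidders[OF n] bval_two_items[OF fin(1)] bval_two_items[OF fin(2)]
      p_def q_def r_def t_def ..
  note unfold = inst_xx_def inst_zw_def inst_wz_def W
  show "0 \<le> welfare n inst_xx A" "welfare n inst_xx A \<le> 2"
    "0 \<le> welfare n inst_zw A" "welfare n inst_zw A \<le> 3*K + 1"
    "0 \<le> welfare n inst_wz A" "welfare n inst_wz A \<le> 3*K + 1"
    unfolding unfold using no K by (cases p; cases q; cases r; cases t; simp)+
  have "1 < welfare n inst_xx A \<Longrightarrow> p \<and> \<not> q \<and> \<not> r \<and> t"
    "2*K + 3 < welfare n inst_zw A \<Longrightarrow> \<not> p \<and> \<not> q \<and> r \<and> t"
    "2*K + 3 < welfare n inst_wz A \<Longrightarrow> p \<and> q \<and> \<not> r \<and> \<not> t"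
    unfolding unfold using no K by (cases p; cases q; cases r; cases t; simp)+
  then show
    "1 < welfare n inst_xx A \<Longrightarrow> 0 \<in> A 0 \<and> 1 \<notin> A 0 \<and> 0 \<notin> A 1 \<and> 1 \<in> A 1"
    "2*K + 3 < welfare n inst_zw A \<Longrightarrow> 0 \<notin> A 0 \<and> 1 \<notin> A 0 \<and> 0 \<in> A 1 \<and> 1 \<in> A 1"
    "2*K + 3 < welfare n inst_wz A \<Longrightarrow> 0 \<in> A 0 \<and> 1 \<in> A 0 \<and> 0 \<notin> A 1 \<and> 1 \<notin> A 1"
    unfolding p_def q_def r_def t_def by blast+
qed

text \<open>Exceeding all three thresholds fixes who gets items 0 and 1 on each profile; then the
  outcome is not constant, yet no bidder can be the first whose types diverge.\<close>

lemma good_mech_loses_somewhere: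
  assumes good: "good_det_mech n m D"
  shows "mech_welfare n D inst_xx \<le> 1 \<or> mech_welfare n D inst_zw \<le> 2*K + 3 \<or>
    mech_welfare n D inst_wz \<le> 2*K + 3"
proof (rule ccontr)
  assume not_lossy: "\<not> ?thesis"
  obtain T S where D: "D = (T, S)" by (cases D)
  have wf: "wf_mech n m T" and vs: "valid_strategies n m T S"
    and od: "\<And>i. i < n \<Longrightarrow> obviously_dominant n m T S i"
    and ir: "indiv_rational n m T S" and nnt: "no_neg_transfers n T"
    using good unfolding good_det_mech_def D by auto
  define run where "run v = (\<lambda>k. S k (v k))" for v :: "nat \<Rightarrow> nat \<Rightarrow> real"
  define alloc where "alloc v = fst (outcome T (run v))" for v
  define pay where "pay v = snd (outcome T (run v))" for v
  have valid: "valid_profile n T (run v)" if "v \<in> profiles n m" for v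
    using vs that unfolding valid_strategies_def valid_profile_def run_def profiles_def by blast
  note feas = feasible_outcome[OF wf valid, folded alloc_def]
  have mw: "mech_welfare n D v = welfare n v (alloc v)" for v
    unfolding mech_welfare_def D alloc_def run_def by simp
  have W: "1 < welfare n inst_xx (alloc inst_xx)" "2*K + 3 < welfare n inst_zw (alloc inst_zw)"
    "2*K + 3 < welfare n inst_wz (alloc inst_wz)"
    using not_lossy unfolding mw by auto
  note gets = welfare_inst(7)[OF feas[OF inst_profiles(1)] W(1)]
    welfare_inst(8)[OF feas[OF inst_profiles(2)] W(2)]
    welfare_inst(9)[OF feas[OF inst_profiles(3)] W(3)]
  have util: "utility T (run v) i (two_items a b) =
      (if 0 \<in> alloc v i then a else 0) + (if 1 \<in> alloc v i then b else 0) - pay v i"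
    if "v \<in> profiles n m" "i < n" for v i a b
  proof -
    have "alloc v i \<subseteq> {..<m}"
      using feas[OF that(1)] that(2) unfolding feasible_def by simp
    then have "finite (alloc v i)"
      by (rule finite_subset) simp
    then show ?thesis
      by (simp add: utility_def bval_two_items flip: alloc_def pay_def)
  qed
  have pay_nonneg: "0 \<le> pay v i" if "v \<in> profiles n m" "i < n" for v i
    using payment_nonneg[OF wf valid nnt] that unfolding pay_def by blast
  have rational: "0 \<le> utility T (run v) i (v i)" if "v \<in> profiles n m" "i < n" for v i
    using ir that unfolding indiv_rational_def run_def by blast
  have n01: "0 < n" "1 < n" using n by auto
  have inst: "inst_xx 0 = two_items 1 0" "inst_zw 0 = two_items 3 K"
    "inst_wz 0 = two_items (2*K) (K+1)" "inst_xx 1 = two_items 0 1"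
    "inst_zw 1 = two_items (K+1) (2*K)" "inst_wz 1 = two_items K 3"
    unfolding inst_xx_def inst_zw_def inst_wz_def two_bidders_def by auto
  \<comment> \<open>Type \<open>x\<close> values what it receives at 1, so individual rationality
    caps its price.\<close>
  have price: "pay inst_xx 0 \<le> 1" "pay inst_xx 1 \<le> 1"
    using rational[OF inst_profiles(1) n01(1)] rational[OF inst_profiles(1) n01(2)]
      util[OF inst_profiles(1) n01(1)] util[OF inst_profiles(1) n01(2)] gets
    unfolding inst by auto
  \<comment> \<open>The runs on all nine type combinations: on the way to a node visited by all of
    them, no type has separated from another.\<close>
  define X where "X = {run (two_bidders y y') | y y'. y \<in> typesA \<and> y' \<in> typesB}"
  have validX: "valid_profile n T B" if "B \<in> X" for B
    using that types_additive unfolding X_def by (auto intro!: valid two_bidders_profile)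
  have inX: "run inst_xx \<in> X" "run inst_zw \<in> X" "run inst_wz \<in> X"
    unfolding X_def inst_xx_def inst_zw_def inst_wz_def typesA_def typesB_def by blast+
  have "(\<exists>out. \<forall>B\<in>X. outcome T B = out) \<or>
    (\<exists>u j Ms c. node_at T u = Some (Node j Ms c) \<and> (\<forall>B\<in>X. u \<in> visits T B) \<and>
       (\<exists>B\<in>X. \<exists>B'\<in>X. B j u \<noteq> B' j u))"
    by (rule first_divergence[OF wf]) (rule validX)
  then show False
  proof (elim disjE exE conjE)
    fix out assume "\<forall>B\<in>X. outcome T B = out"
    then have "alloc inst_xx = alloc inst_zw" using inX unfolding alloc_def by simp
    then show False using gets by simp
  next
    fix u j Ms c
    assume u: "node_at T u = Some (Node j Ms c)" and visit: "\<forall>B\<in>X. u \<in> visits T B"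
      and diff: "\<exists>B\<in>X. \<exists>B'\<in>X. B j u \<noteq> B' j u"
    have visits: "u \<in> visits T (run inst_xx)" "u \<in> visits T (run inst_zw)"
      "u \<in> visits T (run inst_wz)"
      using visit inX by auto
    note valids = valid[OF inst_profiles(1)] valid[OF inst_profiles(2)] valid[OF inst_profiles(3)]
    consider "j = 0" | "j = 1" | "j \<noteq> 0" "j \<noteq> 1" by blast
    then show False
    proof cases
      case 1
      note facts = util[OF inst_profiles(1) n01(1)] util[OF inst_profiles(2) n01(1)]
        util[OF inst_profiles(3) n01(1)]
      have types: "two_items 1 0 \<in> additive_vals m" "two_items 3 K \<in> additive_vals m"
        "two_items (2*K) (K+1) \<in> additive_vals m"
        using types_additive unfolding typesA_def by auto
      have follow: "run inst_xx 0 = S 0 (two_items 1 0)" "run inst_zw 0 = S 0 (two_items 3 K)"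
        "run inst_wz 0 = S 0 (two_items (2*K) (K+1))"
        by (simp_all only: run_def inst)
      \<comment> \<open>Type \<open>z\<close> wins neither item, and no negative transfers excludes
        a subsidy.\<close>
      have idle: "utility T (run inst_zw) 0 (two_items 3 K) \<le> 0"
        using gets pay_nonneg[OF inst_profiles(2) n01(1)] unfolding facts by simp
      have envy: "0 < utility T (run inst_xx) 0 (two_items 3 K)"
        using gets price unfolding facts by simp
      \<comment> \<open>If the payment of \<open>w\<close> is below \<open>K + 3\<close>, then
        \<open>z\<close> envies \<open>w\<close>; otherwise \<open>w\<close> keeps at most
        \<open>2*K - 2\<close>, less than the \<open>2*K - 1\<close> it would get in the place of
        \<open>x\<close>.\<close>
      have "utility T (run inst_wz) 0 (two_items 3 K) = K + 3 - pay inst_wz 0"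
        "utility T (run inst_wz) 0 (two_items (2*K) (K+1)) = 3*K + 1 - pay inst_wz 0"
        "utility T (run inst_xx) 0 (two_items (2*K) (K+1)) \<ge> 2*K - 1"
        using gets price unfolding facts by simp_all
      then have envy': "0 < utility T (run inst_wz) 0 (two_items 3 K) \<or>
          utility T (run inst_wz) 0 (two_items (2*K) (K+1)) < utility T (run inst_xx) 0 (two_items (2*K) (K+1))"
        by linarith
      have "S 0 (two_items 1 0) u = S 0 (two_items 3 K) u"
        "S 0 (two_items (2*K) (K+1)) u = S 0 (two_items 3 K) u"
        using no_separation[OF od[OF n01(1)] types u[unfolded 1]
            valids(1) valids(2) valids(3) visits(1) visits(2) visits(3)
            follow idle envy envy'] by blast+
      then have "S 0 y u = S 0 (two_items 3 K) u" if "y \<in> typesA" for y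
        using that unfolding typesA_def by blast
      then have "B 0 u = S 0 (two_items 3 K) u" if "B \<in> X" for B
        using that unfolding X_def run_def two_bidders_def by fastforce
      then show False using diff unfolding 1 by metis
    next
      \<comment> \<open>The mirror image: bidder 1 is \<open>z\<close> in \<open>inst_wz\<close> and
        \<open>w\<close> in \<open>inst_zw\<close>, so these two runs change roles.\<close>
      case 2
      note facts = util[OF inst_profiles(1) n01(2)] util[OF inst_profiles(2) n01(2)]
        util[OF inst_profiles(3) n01(2)]
      have types: "two_items 0 1 \<in> additive_vals m" "two_items K 3 \<in> additive_vals m"
        "two_items (K+1) (2*K) \<in> additive_vals m"
        using types_additive unfolding typesB_def by auto
      have follow: "run inst_xx 1 = S 1 (two_items 0 1)" "run inst_wz 1 = S 1 (two_items K 3)"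
        "run inst_zw 1 = S 1 (two_items (K+1) (2*K))"
        by (simp_all only: run_def inst)
      have idle: "utility T (run inst_wz) 1 (two_items K 3) \<le> 0"
        using gets pay_nonneg[OF inst_profiles(3) n01(2)] unfolding facts by simp
      have envy: "0 < utility T (run inst_xx) 1 (two_items K 3)"
        using gets price unfolding facts by simp
      have "utility T (run inst_zw) 1 (two_items K 3) = K + 3 - pay inst_zw 1"
        "utility T (run inst_zw) 1 (two_items (K+1) (2*K)) = 3*K + 1 - pay inst_zw 1"
        "utility T (run inst_xx) 1 (two_items (K+1) (2*K)) \<ge> 2*K - 1"
        using gets price unfolding facts by simp_all
      then have envy': "0 < utility T (run inst_zw) 1 (two_items K 3) \<or>
          utility T (run inst_zw) 1 (two_items (K+1) (2*K)) < utility T (run inst_xx) 1 (two_items (K+1) (2*K))"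
        by linarith
      have "S 1 (two_items 0 1) u = S 1 (two_items K 3) u"
        "S 1 (two_items (K+1) (2*K)) u = S 1 (two_items K 3) u"
        using no_separation[OF od[OF n01(2)] types u[unfolded 2]
            valids(1) valids(3) valids(2) visits(1) visits(3) visits(2)
            follow idle envy envy'] by blast+
      then have "S 1 y u = S 1 (two_items K 3) u" if "y \<in> typesB" for y
        using that unfolding typesB_def by blast
      then have "B 1 u = S 1 (two_items K 3) u" if "B \<in> X" for B
        using that unfolding X_def run_def two_bidders_def by fastforce
      then show False using diff unfolding 2 by metis
    next
      \<comment> \<open>Any other bidder has the zero valuation throughout \<open>X\<close> and
        hence a single behavior.\<close>
      case 3
      then have "B j = S j (\<lambda>_. 0)" if "B \<in> X" for B
        using that unfolding X_def run_def two_bidders_def by fastforce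
      then show False using diff by metis
    qed
  qed
qed

text \<open>The weighted optimum is \<open>24*K + 8\<close>. The weights nearly equalize the
  possible losses: at least \<open>3*K + 1\<close> on \<open>inst_xx\<close>, and at least
  \<open>3*(K - 2)\<close> on either other instance. The bound subtracts the smaller loss.\<close>

lemma good_mech_welfare_bound:
  assumes "good_det_mech n m D"
  shows "(3*K + 1) * mech_welfare n D inst_xx + 3 * mech_welfare n D inst_zw
    + 3 * mech_welfare n D inst_wz \<le> 21*K + 14"
proof -
  note feas = good_mech_feasible[OF assms]
  have b: "mech_welfare n D inst_xx \<le> 2" "mech_welfare n D inst_zw \<le> 3*K + 1"
    "mech_welfare n D inst_wz \<le> 3*K + 1"
    unfolding mech_welfare_def
    using welfare_inst(2)[OF feas[OF inst_profiles(1)]] welfare_inst(4)[OF feas[OF inst_profiles(2)]]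
      welfare_inst(6)[OF feas[OF inst_profiles(3)]] by auto
  \<comment> \<open>Naming the product keeps the remaining goals linear.\<close>
  define Y where "Y = (3*K + 1) * mech_welfare n D inst_xx"
  have scale: "Y \<le> (3*K + 1) * y" if "mech_welfare n D inst_xx \<le> y" for y
    unfolding Y_def using that K by (intro mult_left_mono) auto
  have "Y + 3 * mech_welfare n D inst_zw + 3 * mech_welfare n D inst_wz \<le> 21*K + 14"
    using good_mech_loses_somewhere[OF assms]
  proof (elim disjE)
    assume "mech_welfare n D inst_xx \<le> 1"
    from scale[OF this] show ?thesis using b by simp
  qed (use b scale[OF b(1)] K in simp_all)
  then show ?thesis unfolding Y_def .
qed

section \<open>Averaging over the randomized mechanism and choosing \<open>K\<close>\<close>

lemma expected_welfare_bound:
  assumes "prob_space M" and good: "AE D in M. good_det_mech n m D"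
    and meas: "\<And>v. v \<in> profiles n m \<Longrightarrow> (\<lambda>D. mech_welfare n D v) \<in> borel_measurable M"
  shows "(3*K + 1) * (\<integral>D. mech_welfare n D inst_xx \<partial>M) + 3 * (\<integral>D. mech_welfare n D inst_zw \<partial>M)
    + 3 * (\<integral>D. mech_welfare n D inst_wz \<partial>M) \<le> 21*K + 14"
proof -
  interpret prob_space M by fact
  have int: "integrable M (\<lambda>D. mech_welfare n D inst_xx)"
    "integrable M (\<lambda>D. mech_welfare n D inst_zw)" "integrable M (\<lambda>D. mech_welfare n D inst_wz)"
  proof -
    show "integrable M (\<lambda>D. mech_welfare n D inst_xx)"
    proof (rule integrable_const_bound[where B = 2])
      show "AE D in M. norm (mech_welfare n D inst_xx) \<le> 2"
        using good by eventually_elim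
          (simp add: mech_welfare_def welfare_inst(1,2) good_mech_feasible inst_profiles)
    qed (rule meas[OF inst_profiles(1)])
    show "integrable M (\<lambda>D. mech_welfare n D inst_zw)"
    proof (rule integrable_const_bound[where B = "3*K + 1"])
      show "AE D in M. norm (mech_welfare n D inst_zw) \<le> 3*K + 1"
        using good by eventually_elim
          (simp add: mech_welfare_def welfare_inst(3,4) good_mech_feasible inst_profiles)
    qed (rule meas[OF inst_profiles(2)])
    show "integrable M (\<lambda>D. mech_welfare n D inst_wz)"
    proof (rule integrable_const_bound[where B = "3*K + 1"])
      show "AE D in M. norm (mech_welfare n D inst_wz) \<le> 3*K + 1"
        using good by eventually_elim
          (simp add: mech_welfare_def welfare_inst(5,6) good_mech_feasible inst_profiles)
    qed (rule meas[OF inst_profiles(3)])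
  qed
  have "(\<integral>D. (3*K + 1) * mech_welfare n D inst_xx + 3 * mech_welfare n D inst_zw
      + 3 * mech_welfare n D inst_wz \<partial>M) \<le> (\<integral>D. 21*K + 14 \<partial>M)"
    using good int by (intro integral_mono_AE) (auto elim!: eventually_mono intro: good_mech_welfare_bound)
  then show ?thesis using int by (simp add: prob_space)
qed

end

theorem theorem4p4:
  fixes n m :: nat
    and M :: "('msg mech \<times> 'msg strategies) measure"
  assumes "2 \<le> m" and "2 \<le> n"
    and "prob_space M"
    and "AE D in M. good_det_mech n m D"
    and "\<And>v. v \<in> profiles n m \<Longrightarrow> (\<lambda>D. mech_welfare n D v) \<in> borel_measurable M"
  shows "\<forall>\<alpha>::real. \<alpha> < 8/7 \<longrightarrow>
           (\<exists>v\<in>profiles n m. \<alpha> * (\<integral>D. mech_welfare n D v \<partial>M) < OPT n m v)"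
proof (intro allI impI, rule ccontr)
  fix \<alpha> :: real
  assume \<alpha>: "\<alpha> < 8/7"
    and "\<not> (\<exists>v\<in>profiles n m. \<alpha> * (\<integral>D. mech_welfare n D v \<partial>M) < OPT n m v)"
  then have le: "OPT n m v \<le> \<alpha> * (\<integral>D. mech_welfare n D v \<partial>M)" if "v \<in> profiles n m" for v
    using that by (meson not_le)
  \<comment> \<open>The bounds below will give
    \<open>K * (24 - 21 * \<alpha>) \<le> 14 * \<alpha> - 8\<close>, which is less than 8 because
    \<open>\<alpha> < 8/7\<close>; this choice makes the left side at least 10.\<close>
  define K where "K = max 2 (10 / (24 - 21 * \<alpha>))"
  have K: "2 \<le> K" "10 \<le> K * (24 - 21 * \<alpha>)"
  proof -
    have "0 < 24 - 21 * \<alpha>" using \<alpha> by simp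
    moreover have "10 / (24 - 21 * \<alpha>) \<le> K" unfolding K_def by simp
    ultimately show "10 \<le> K * (24 - 21 * \<alpha>)" by (simp add: pos_divide_le_eq)
  qed (simp add: K_def)
  define E where "E v = (\<integral>D. mech_welfare n D v \<partial>M)" for v
  define total where "total = (3*K + 1) * E inst_xx + 3 * E (inst_zw K) + 3 * E (inst_wz K)"
  note inst = inst_profiles[OF assms(1,2) K(1)]
  have opt: "2 \<le> \<alpha> * E inst_xx" "3*K + 1 \<le> \<alpha> * E (inst_zw K)" "3*K + 1 \<le> \<alpha> * E (inst_wz K)"
    unfolding E_def
    by (rule order_trans[OF OPT_inst(1)[OF assms(1,2) K(1)] le[OF inst(1)]]
        order_trans[OF OPT_inst(2)[OF assms(1,2) K(1)] le[OF inst(2)]]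
        order_trans[OF OPT_inst(3)[OF assms(1,2) K(1)] le[OF inst(3)]])+
  have "(3*K + 1) * 2 + 3 * (3*K + 1) + 3 * (3*K + 1)
      \<le> (3*K + 1) * (\<alpha> * E inst_xx) + 3 * (\<alpha> * E (inst_zw K)) + 3 * (\<alpha> * E (inst_wz K))"
    using opt K(1) by (intro add_mono mult_left_mono) auto
  also have "\<dots> = \<alpha> * total"
    unfolding total_def by (simp add: algebra_simps)
  finally have lower: "24*K + 8 \<le> \<alpha> * total" by simp
  have upper: "total \<le> 21*K + 14"
    using expected_welfare_bound[OF assms(1,2) K(1) assms(3-5)] unfolding total_def E_def by simp
  \<comment> \<open>Nonnegative expectations settle negative \<open>\<alpha>\<close>, where the
    upper bound on \<open>total\<close> cannot be multiplied by \<open>\<alpha>\<close>.\<close>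
  have nonneg: "0 \<le> E v" if "v \<in> profiles n m"
    and "\<And>A. feasible n m A \<Longrightarrow> 0 \<le> welfare n v A" for v
    unfolding E_def mech_welfare_def using assms(4) that
    by (intro integral_nonneg_AE) (auto elim!: eventually_mono intro: good_mech_feasible)
  have "0 \<le> E inst_xx" "0 \<le> E (inst_zw K)" "0 \<le> E (inst_wz K)"
    using nonneg inst welfare_inst(1,3,5)[OF assms(1,2) K(1)] by blast+
  then have "0 \<le> total" unfolding total_def using K(1) by simp
  show False
  proof (cases "0 \<le> \<alpha>")
    case True
    then have "24*K + 8 \<le> \<alpha> * (21*K + 14)"
      using lower upper mult_left_mono[OF upper True] by linarith
    then show False using K(2) \<alpha> by (simp add: algebra_simps)
  next
    case False
    then have "\<alpha> * total \<le> 0" using \<open>0 \<le> total\<close> by (simp add: mult_nonpos_nonneg)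
    then show False using lower K(1) by linarith
  qed
qed

end
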